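(* For $p\in\mathbb R$ let $L_p$ denote the generalized logarithmic mean, and let $A(a,b)=\frac{a+b}{2}$ and $H(a,b)=\frac{2ab}{a+b}$ for $a,b>0$. For the class of means $\{L_p\}_{p\in\mathbb R}$, the harmonic mean $H$ is a left cancelling mean and the arithmetic mean $A$ is a right cancelling mean. Moreover, for all $p$ with $-3<p<3$ and all $a,b>0$ with $a\ne b$, $$H(a,b)<L_{-3}(a,b)<L_p(a,b)<L_3(a,b)<A(a,b),$$ and these bounds are best possible: $p=3$ is the largest real $p$ such that $L_p(a,b)\le A(a,b)$ for all $a,b>0$, and $p=-3$ is the smallest real $p$ such that $H(a,b)\le L_p(a,b)$ for all $a,b>0$.
   Context: A mean is a map $M:\mathbb R_+\times\mathbb R_+\to\mathbb R_+$ (with $\mathbb R_+=(0,\infty)$) such that $\min(a,b)\le M(a,b)\le\max(a,b)$ for all $a,b>0$. $\Omega$ is the class of means that are symmetric, reflexive ($M(a,a)=a$) and homogeneous of order one. For means, $M\le N$ means $M(a,b)\le N(a,b)$ for all $a,b>0$; a family $\Delta$ of means is ordered if for any $M,N\in\Delta$ one has $M\le N$ or $N\le M$. Let $\Delta\subset\Omega$ be an ordered class of means. A mean $S^*$ is a right cancelling mean for $\Delta$ if there exists $M\in\Delta$ with $S^*\ge M$, but there is no $N\in\Delta$ such that $N(a,b)\ge S^*(a,b)$ for all $a,b>0$. A mean $S_*$ is a left cancelling mean for $\Delta$ if there exists $M\in\Delta$ with $S_*\le M$, but there is no $N\in\Delta$ such that $N(a,b)\le S_*(a,b)$ for all $a,b>0$.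 The generalized logarithmic means are, for $a,b>0$, $a\neq b$, $$L_p(a,b)=\Bigl(\frac{a^p-b^p}{p(\log a-\log b)}\Bigr)^{1/p}\quad (p\neq0),\qquad L_0(a,b)=\sqrt{ab},$$ with $L_p(a,a)=a$. They belong to $\Omega$, and $L_p$ is monotone increasing in $p$, so $\{L_p\}$ is ordered. *)

theory Defs
  imports Complex_Main
begin

text \<open>
  A map on the positive quadrant is represented by a total function \<^typ>\<open>real \<Rightarrow> real \<Rightarrow> real\<close>;
  every notion below only looks at its values at positive arguments.
\<close>

definition is_mean :: "(real \<Rightarrow> real \<Rightarrow> real) \<Rightarrow> bool" where
  "is_mean M \<longleftrightarrow> (\<forall>a>0. \<forall>b>0. min a b \<le> M a b \<and> M a b \<le> max a b)"

definition mean_le :: "(real \<Rightarrow> real \<Rightarrow> real) \<Rightarrow> (real \<Rightarrow> real \<Rightarrow> real) \<Rightarrow> bool" where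
  "mean_le M N \<longleftrightarrow> (\<forall>a>0. \<forall>b>0. M a b \<le> N a b)"

definition Omega :: "(real \<Rightarrow> real \<Rightarrow> real) set" where
  "Omega = {M. is_mean M
      \<and> (\<forall>a>0. \<forall>b>0. M a b = M b a)
      \<and> (\<forall>a>0. M a a = a)
      \<and> (\<forall>c>0. \<forall>a>0. \<forall>b>0. M (c * a) (c * b) = c * M a b)}"

definition ordered_family :: "(real \<Rightarrow> real \<Rightarrow> real) set \<Rightarrow> bool" where
  "ordered_family \<Delta> \<longleftrightarrow> (\<forall>M\<in>\<Delta>. \<forall>N\<in>\<Delta>. mean_le M N \<or> mean_le N M)"

text \<open>
  Cancelling means are only spoken of relative to an ordered class contained in \<^const>\<open>Omega\<close>;
  this requirement on \<open>\<Delta>\<close> is part of the two predicates.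
\<close>

definition right_cancelling_mean ::
    "(real \<Rightarrow> real \<Rightarrow> real) set \<Rightarrow> (real \<Rightarrow> real \<Rightarrow> real) \<Rightarrow> bool" where
  "right_cancelling_mean \<Delta> S \<longleftrightarrow>
     \<Delta> \<subseteq> Omega \<and> ordered_family \<Delta> \<and> is_mean S
     \<and> (\<exists>M\<in>\<Delta>. mean_le M S) \<and> \<not> (\<exists>N\<in>\<Delta>. mean_le S N)"

definition left_cancelling_mean ::
    "(real \<Rightarrow> real \<Rightarrow> real) set \<Rightarrow> (real \<Rightarrow> real \<Rightarrow> real) \<Rightarrow> bool" where
  "left_cancelling_mean \<Delta> S \<longleftrightarrow>
     \<Delta> \<subseteq> Omega \<and> ordered_family \<Delta> \<and> is_mean S
     \<and> (\<exists>M\<in>\<Delta>. mean_le S M) \<and> \<not> (\<exists>N\<in>\<Delta>. mean_le N S)"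

definition gen_log_mean :: "real \<Rightarrow> real \<Rightarrow> real \<Rightarrow> real" where
  "gen_log_mean p a b =
     (if a = b then a
      else if p = 0 then sqrt (a * b)
      else ((a powr p - b powr p) / (p * (ln a - ln b))) powr (1 / p))"

definition arith_mean :: "real \<Rightarrow> real \<Rightarrow> real" where
  "arith_mean a b = (a + b) / 2"

definition harm_mean :: "real \<Rightarrow> real \<Rightarrow> real" where
  "harm_mean a b = 2 * a * b / (a + b)"

end

theory Submission
  imports Defs "HOL-Real_Asymp.Real_Asymp"
begin

text \<open>
  In the coordinates \<open>a = exp (m + t)\<close>, \<open>b = exp (m - t)\<close> the logarithms of \<open>L\<^sub>p\<close>, \<open>A\<close> and \<open>H\<close>
  are \<open>m + t * \<psi> (p * t)\<close>, \<open>m + ln (cosh t)\<close> and \<open>m - ln (cosh t)\<close>, where the odd function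
  \<open>\<psi> u = ln (sinh u / u) / u\<close> is strictly increasing with values in \<open>[-1, 1]\<close>.  Hence \<open>L\<^sub>p\<close> is a
  strictly increasing family of means and every statement about \<open>H\<close> mirrors one about \<open>A\<close>.  The
  inequality \<open>L\<^sub>3 < A\<close> says \<open>3 T + T^3 < 3 t\<close> for \<open>T = tanh t\<close>, where the difference has
  derivative \<open>3 T^4\<close>.  Sharpness of \<open>3\<close> comes from the second-order expansion at \<open>t = 0\<close>, and
  no \<open>L\<^sub>p\<close> dominates \<open>A\<close> because \<open>t * \<psi> (p * t) - ln (cosh t)\<close> tends to \<open>-\<infinity>\<close> as
  \<open>t\<close> grows.
\<close>

text \<open>The junk values \<open>0 / 0 = 0\<close> and \<open>ln 0 = 0\<close> give the intended value \<open>log_sinhc_slope 0 = 0\<close>.\<close>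

definition log_sinhc_slope :: "real \<Rightarrow> real" where
  "log_sinhc_slope u = ln (sinh u / u) / u"

lemma log_sinhc_slope_0 [simp]: "log_sinhc_slope 0 = 0"
  by (simp add: log_sinhc_slope_def)

lemma log_sinhc_slope_minus [simp]: "log_sinhc_slope (- u) = - log_sinhc_slope u"
  by (simp add: log_sinhc_slope_def)

section \<open>Bounds and monotonicity of \<open>log_sinhc_slope\<close>\<close>

lemma less_sinh:
  fixes u :: real
  assumes "u > 0"
  shows "u < sinh u"
proof -
  have "sinh 0 - 0 < sinh u - u"
  proof (rule DERIV_pos_imp_increasing_open[OF assms])
    fix x :: real assume "0 < x" "x < u"
    have "((\<lambda>x. sinh x - x) has_real_derivative cosh x - 1) (at x)"
      by (auto intro!: derivative_eq_intros)
    moreover have "cosh x > 1"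
      using cosh_real_strict_mono[of 0 x] \<open>0 < x\<close> by simp
    ultimately show "\<exists>y. ((\<lambda>x. sinh x - x) has_real_derivative y) (at x) \<and> 0 < y"
      by (intro exI[of _ "cosh x - 1"]) auto
  qed (auto intro!: continuous_intros)
  then show ?thesis by simp
qed

lemma log_sinhc_slope_pos: "u > 0 \<Longrightarrow> log_sinhc_slope u > 0"
  using less_sinh[of u] by (simp add: log_sinhc_slope_def)

text \<open>It suffices that sinh u / u is at most exp u, which after division by exp u is 1 - exp
  (-2u) \<le> 2u.\<close>

lemma log_sinhc_slope_le_1:
  assumes "u > 0"
  shows "log_sinhc_slope u \<le> 1"
proof -
  have "exp u * (1 - exp (- (2 * u))) \<le> exp u * (2 * u)"
    using exp_ge_add_one_self[of "- (2 * u)"] by (intro mult_left_mono) auto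
  then have "sinh u / u \<le> exp u"
    using assms by (simp add: sinh_field_def field_simps flip: exp_add)
  moreover have "sinh u / u > 0"
    using assms by simp
  ultimately have "ln (sinh u / u) \<le> ln (exp u)"
    by (subst ln_le_cancel_iff) auto
  then show ?thesis
    using assms by (simp add: log_sinhc_slope_def)
qed

lemma abs_log_sinhc_slope_le_1: "\<bar>log_sinhc_slope u\<bar> \<le> 1"
  using log_sinhc_slope_le_1[of u] log_sinhc_slope_pos[of u]
    log_sinhc_slope_le_1[of "- u"] log_sinhc_slope_pos[of "- u"]
  by (cases u "0 :: real" rule: linorder_cases) auto

text \<open>The difference of the two sides is, up to the factor 1 / u^2, the derivative of
  \<open>log_sinhc_slope\<close>. It vanishes in the limit at 0 and increases, since its own
  derivative 1 / x - x / sinh^2 x is positive by \<open>less_sinh\<close>.\<close>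

lemma ln_sinhc_less:
  fixes u :: real
  assumes u: "u > 0"
  shows "ln (sinh u / u) < u * cosh u / sinh u - 1"
proof -
  define h :: "real \<Rightarrow> real" where "h x = x * cosh x / sinh x - 1 - ln (sinh x / x)" for x
  have deriv: "(h has_real_derivative 1 / x - x / sinh x ^ 2) (at x)" if "x > 0" for x
  proof -
    have s: "sinh x > 0" using that by simp
    have "(h has_real_derivative ((cosh x + x * sinh x) * sinh x - x * cosh x * cosh x) / (sinh x)\<^sup>2
        - (cosh x * x - sinh x) / x\<^sup>2 / (sinh x / x)) (at x)"
      unfolding h_def using that s
      by (auto intro!: derivative_eq_intros simp: power2_eq_square ac_simps)
    also have "((cosh x + x * sinh x) * sinh x - x * cosh x * cosh x) / (sinh x)\<^sup>2
        - (cosh x * x - sinh x) / x\<^sup>2 / (sinh x / x)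
      = 1 / x - x * ((cosh x)\<^sup>2 - (sinh x)\<^sup>2) / (sinh x)\<^sup>2"
      using that s by (simp add: field_simps power2_eq_square)
    finally show ?thesis
      by (simp add: cosh_square_eq)
  qed
  have mono: "h x < h y" if "0 < x" "x < y" for x y
  proof (rule DERIV_pos_imp_increasing[OF \<open>x < y\<close>])
    fix z assume "x \<le> z" "z \<le> y"
    then have "z > 0" using that by simp
    have "z ^ 2 < sinh z ^ 2"
      using less_sinh[OF \<open>z > 0\<close>] \<open>z > 0\<close> by (intro power_strict_mono) auto
    then have "1 / z - z / sinh z ^ 2 > 0"
      using \<open>z > 0\<close> by (simp add: field_simps power2_eq_square)
    then show "\<exists>d. (h has_real_derivative d) (at z) \<and> 0 < d"
      using deriv[OF \<open>z > 0\<close>] by blast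
  qed
  \<comment> \<open>The limit yields only a weak inequality; the intermediate point u / 2 restores
    strictness.\<close>
  have "(h \<longlongrightarrow> 0) (at_right 0)"
    unfolding h_def sinh_field_def cosh_field_def by real_asymp
  moreover have "eventually (\<lambda>x. h x \<le> h (u / 2)) (at_right 0)"
    using eventually_at_right_real[of 0 "u / 2"] u
    by (auto elim!: eventually_mono intro!: less_imp_le mono)
  ultimately have "0 \<le> h (u / 2)"
    by (intro tendsto_upperbound) auto
  also have "\<dots> < h u" using u by (intro mono) auto
  finally show ?thesis by (simp add: h_def)
qed

lemma log_sinhc_slope_strict_mono_pos:
  assumes "0 < u" "u < v"
  shows "log_sinhc_slope u < log_sinhc_slope v"
proof (rule DERIV_pos_imp_increasing[OF \<open>u < v\<close>])
  fix x assume "u \<le> x" "x \<le> v"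
  then have x: "x > 0" using assms by simp
  then have s: "sinh x > 0" by simp
  let ?d = "(x * cosh x / sinh x - 1 - ln (sinh x / x)) / x\<^sup>2"
  have "((\<lambda>x. ln (sinh x / x) / x) has_real_derivative ?d) (at x)"
    using x s by (auto intro!: derivative_eq_intros simp: divide_simps)
      (simp add: algebra_simps power2_eq_square)
  moreover have "?d > 0"
    using ln_sinhc_less[OF x] x by simp
  ultimately show "\<exists>d. (log_sinhc_slope has_real_derivative d) (at x) \<and> 0 < d"
    unfolding log_sinhc_slope_def[abs_def] by blast
qed

text \<open>Oddness carries the positive case over to negative arguments; across 0 the signs of the
  values decide.\<close>

lemma log_sinhc_slope_strict_mono: "u < v \<Longrightarrow> log_sinhc_slope u < log_sinhc_slope v"
  using log_sinhc_slope_strict_mono_pos[of u v] log_sinhc_slope_strict_mono_pos[of "- v" "- u"]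
    log_sinhc_slope_pos[of v] log_sinhc_slope_pos[of "- u"]
  by (cases u "0 :: real" rule: linorder_cases; cases v "0 :: real" rule: linorder_cases) auto

lemma log_sinhc_slope_mono: "u \<le> v \<Longrightarrow> log_sinhc_slope u \<le> log_sinhc_slope v"
  using log_sinhc_slope_strict_mono[of u v] by (cases "u = v") auto

section \<open>The means in exponential coordinates\<close>

lemma sinh_divide_self_pos:
  fixes x :: real
  assumes "x \<noteq> 0"
  shows "sinh x / x > 0"
  using assms by (cases x "0 :: real" rule: linorder_cases) (auto simp: zero_less_divide_iff)

text \<open>The difference of the p-th powers is 2 exp (p m) sinh (p t) and the difference of the
  logarithms is 2 t; taking the p-th root divides the exponent by p.\<close>

lemma gen_log_mean_exp:
  "gen_log_mean p (exp (m + t)) (exp (m - t)) = exp (m + t * log_sinhc_slope (p * t))"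
proof -
  consider "t = 0" | "t \<noteq> 0" "p = 0" | "t \<noteq> 0" "p \<noteq> 0" by blast
  then show ?thesis
  proof cases
    case 2
    \<comment> \<open>The geometric mean is exp m, which fits the formula because
      \<open>log_sinhc_slope 0 = 0\<close>.\<close>
    have "exp (m + t) * exp (m - t) = (exp m)\<^sup>2"
      by (simp add: power2_eq_square flip: exp_add)
    then show ?thesis using 2 by (simp add: gen_log_mean_def)
  next
    case 3
    define q where "q = sinh (p * t) / (p * t)"
    have q: "q > 0"
      using 3 by (simp add: q_def sinh_divide_self_pos)
    have "exp (m + t) powr p = exp (p * m) * exp (p * t)"
      "exp (m - t) powr p = exp (p * m) * exp (- (p * t))"
      by (simp_all add: powr_def distrib_left right_diff_distrib flip: exp_add)
    then have "exp (m + t) powr p - exp (m - t) powr p = exp (p * m) * (2 * sinh (p * t))"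
      by (simp add: sinh_field_def right_diff_distrib)
    then have "(exp (m + t) powr p - exp (m - t) powr p) / (p * (2 * t)) = exp (p * m) * q"
      using 3 by (simp add: q_def field_simps)
    moreover have "\<dots> = exp (p * m + ln q)"
      using q by (simp add: exp_add)
    ultimately have "gen_log_mean p (exp (m + t)) (exp (m - t)) = exp ((p * m + ln q) / p)"
      using 3 by (simp add: gen_log_mean_def powr_def)
    also have "(p * m + ln q) / p = m + t * log_sinhc_slope (p * t)"
      using 3 by (simp add: log_sinhc_slope_def q_def field_simps)
    finally show ?thesis .
  qed (simp add: gen_log_mean_def)
qed

lemma arith_mean_exp: "arith_mean (exp (m + t)) (exp (m - t)) = exp (m + ln (cosh t))"
proof -
  have "exp (m + t) + exp (m - t) = 2 * exp m * cosh t"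
    by (simp add: cosh_field_def exp_add exp_diff exp_minus field_simps)
  then show ?thesis
    by (simp add: arith_mean_def exp_add)
qed

lemma harm_mean_exp: "harm_mean (exp (m + t)) (exp (m - t)) = exp (m - ln (cosh t))"
proof -
  have "exp (m + t) + exp (m - t) = 2 * exp m * cosh t"
    by (simp add: cosh_field_def exp_add exp_diff exp_minus field_simps)
  moreover have "2 * exp (m + t) * exp (m - t) = 2 * exp m * exp m"
    by (simp flip: exp_add)
  ultimately show ?thesis
    by (simp add: harm_mean_def exp_diff)
qed

lemma exp_coordinates:
  fixes a b :: real
  assumes "a > 0" "b > 0"
  obtains m t where "a = exp (m + t)" "b = exp (m - t)"
proof
  have "(ln a + ln b) / 2 + (ln a - ln b) / 2 = ln a"
    "(ln a + ln b) / 2 - (ln a - ln b) / 2 = ln b"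
    by (simp_all add: field_simps)
  then show "a = exp ((ln a + ln b) / 2 + (ln a - ln b) / 2)"
    "b = exp ((ln a + ln b) / 2 - (ln a - ln b) / 2)"
    using assms by simp_all
qed

lemma exp_coordinates_ordered:
  fixes a b :: real
  assumes "a > 0" "b > 0" "b < a"
  obtains m t where "a = exp (m + t)" "b = exp (m - t)" "t > 0"
proof -
  obtain m t where ab: "a = exp (m + t)" "b = exp (m - t)"
    using exp_coordinates[OF assms(1,2)] .
  moreover have "t > 0"
    using assms(3) by (simp add: ab)
  ultimately show thesis by (rule that)
qed

section \<open>Order of the family and membership in \<open>Omega\<close>\<close>

lemma gen_log_mean_commute:
  assumes "a > 0" "b > 0"
  shows "gen_log_mean p a b = gen_log_mean p b a"
proof -
  obtain m t where ab: "a = exp (m + t)" "b = exp (m - t)"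
    using exp_coordinates[OF assms] .
  show ?thesis
    unfolding ab using gen_log_mean_exp[of p m t] gen_log_mean_exp[of p m "- t"] by simp
qed

lemma gen_log_mean_strict_mono:
  assumes "a > 0" "b > 0" "a \<noteq> b" "p < q"
  shows "gen_log_mean p a b < gen_log_mean q a b"
proof -
  have *: "gen_log_mean p a b < gen_log_mean q a b" if "a > 0" "b > 0" "b < a" for a b
  proof -
    obtain m t where "a = exp (m + t)" "b = exp (m - t)" "t > 0"
      using exp_coordinates_ordered[OF \<open>a > 0\<close> \<open>b > 0\<close> \<open>b < a\<close>] .
    then show ?thesis
      using log_sinhc_slope_strict_mono[of "p * t" "q * t"] \<open>p < q\<close>
      by (simp add: gen_log_mean_exp)
  qed
  show ?thesis
    using *[of a b] *[of b a] assms
      gen_log_mean_commute[of a b p] gen_log_mean_commute[of a b q] by (cases "b < a") auto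
qed

lemma gen_log_mean_mono: "p \<le> q \<Longrightarrow> mean_le (gen_log_mean p) (gen_log_mean q)"
  unfolding mean_le_def
proof (intro allI impI)
  fix a b :: real assume "p \<le> q" "a > 0" "b > 0"
  then show "gen_log_mean p a b \<le> gen_log_mean q a b"
    using gen_log_mean_strict_mono[of a b p q]
    by (cases "a = b"; cases "p = q") (auto simp: gen_log_mean_def[of _ b b])
qed

lemma ordered_family_gen_log_mean: "ordered_family (range gen_log_mean)"
  by (auto simp: ordered_family_def) (metis gen_log_mean_mono linear)

lemma is_mean_gen_log_mean: "is_mean (gen_log_mean p)"
  unfolding is_mean_def
proof (intro allI impI)
  fix a b :: real assume "a > 0" "b > 0"
  then obtain m t where ab: "a = exp (m + t)" "b = exp (m - t)"
    using exp_coordinates by blast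
  \<comment> \<open>The logarithms of min and max are m - |t| and m + |t|, so |d| \<le> |t| is all
    that is needed.\<close>
  define d where "d = t * log_sinhc_slope (p * t)"
  have "\<bar>d\<bar> \<le> \<bar>t\<bar>"
    using abs_log_sinhc_slope_le_1[of "p * t"] by (simp add: d_def abs_mult mult_left_le)
  then show "min a b \<le> gen_log_mean p a b \<and> gen_log_mean p a b \<le> max a b"
    by (auto simp: ab gen_log_mean_exp min_def max_def simp flip: d_def)
qed

lemma gen_log_mean_mult:
  assumes "c > 0" "a > 0" "b > 0"
  shows "gen_log_mean p (c * a) (c * b) = c * gen_log_mean p a b"
proof -
  obtain m t where ab: "a = exp (m + t)" "b = exp (m - t)"
    using exp_coordinates[OF assms(2,3)] .
  have "c * a = exp ((ln c + m) + t)" "c * b = exp ((ln c + m) - t)"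
    using assms(1) by (simp_all add: ab exp_add exp_diff)
  then have "gen_log_mean p (c * a) (c * b) = exp ((ln c + m) + t * log_sinhc_slope (p * t))"
    by (simp only: gen_log_mean_exp)
  also have "\<dots> = c * exp (m + t * log_sinhc_slope (p * t))"
    using assms(1) by (simp add: exp_add)
  finally show ?thesis
    by (simp add: ab gen_log_mean_exp)
qed

lemma gen_log_mean_in_Omega: "gen_log_mean p \<in> Omega"
  using is_mean_gen_log_mean gen_log_mean_commute gen_log_mean_mult
  by (simp add: Omega_def gen_log_mean_def[of _ a a for a])

lemma is_mean_arith_mean: "is_mean arith_mean"
  by (auto simp: is_mean_def arith_mean_def min_def max_def)

lemma is_mean_harm_mean: "is_mean harm_mean"
  unfolding is_mean_def
proof (intro allI impI)
  fix a b :: real assume "a > 0" "b > 0"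
  then show "min a b \<le> harm_mean a b \<and> harm_mean a b \<le> max a b"
    by (auto simp: harm_mean_def min_def max_def field_simps)
qed

section \<open>Strict inequalities at the exponents 3 and -3\<close>

lemma tanh_cubic_less:
  fixes t :: real
  assumes "t > 0"
  shows "3 * tanh t + tanh t ^ 3 < 3 * t"
proof -
  have "3 * 0 - (3 * tanh 0 + tanh 0 ^ 3) < 3 * t - (3 * tanh t + tanh t ^ 3)"
  proof (rule DERIV_pos_imp_increasing_open[OF assms])
    fix x :: real assume "0 < x" "x < t"
    have "cosh x \<noteq> 0" by simp
    \<comment> \<open>With T = tanh x and T' = 1 - T^2, the derivative of 3 T + T^3 is 3 (1 + T^2)
      (1 - T^2) = 3 - 3 T^4.\<close>
    then have "((\<lambda>x. 3 * x - (3 * tanh x + tanh x ^ 3)) has_real_derivative 3 * tanh x ^ 4) (at x)"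
      by (auto intro!: derivative_eq_intros) (simp add: algebra_simps power_numeral_reduce)
    moreover have "3 * tanh x ^ 4 > 0"
      using \<open>0 < x\<close> by simp
    ultimately show "\<exists>y. ((\<lambda>x. 3 * x - (3 * tanh x + tanh x ^ 3)) has_real_derivative y) (at x)
        \<and> 0 < y"
      by blast
  qed (auto intro!: continuous_intros)
  then show ?thesis by simp
qed

lemma sinh_triple:
  fixes x :: real
  shows "sinh (3 * x) = 3 * sinh x * cosh x ^ 2 + sinh x ^ 3"
proof -
  have "sinh (3 * x) = sinh (2 * x + x)" by simp
  also have "\<dots> = 3 * sinh x * cosh x ^ 2 + sinh x ^ 3"
    by (simp only: sinh_add sinh_double cosh_double) (simp add: algebra_simps power_numeral_reduce)
  finally show ?thesis .
qed

text \<open>Factoring cosh^3 t out of the triple-angle formula turns \<open>tanh_cubic_less\<close>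
  into sinh (3 t) / (3 t) < cosh^3 t; the claim is a third of its logarithm.\<close>

lemma log_sinhc_slope_3_less:
  assumes "t > 0"
  shows "t * log_sinhc_slope (3 * t) < ln (cosh t)"
proof -
  have c: "cosh t > 0" by simp
  have "sinh (3 * t) = cosh t ^ 3 * (3 * tanh t + tanh t ^ 3)"
    using c unfolding sinh_triple by (simp add: tanh_def field_simps power_numeral_reduce)
  also have "\<dots> < cosh t ^ 3 * (3 * t)"
    using tanh_cubic_less[OF assms] by simp
  finally have "sinh (3 * t) / (3 * t) < cosh t ^ 3"
    using assms by (simp add: field_simps)
  then have "ln (sinh (3 * t) / (3 * t)) < ln (cosh t ^ 3)"
    using assms by (subst ln_less_cancel_iff) auto
  also have "\<dots> = 3 * ln (cosh t)"
    by (simp add: ln_realpow)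
  finally show ?thesis
    using assms by (simp add: log_sinhc_slope_def)
qed

text \<open>By oddness of \<open>log_sinhc_slope\<close>, both bounds are the same inequality in
  t.\<close>

lemma gen_log_mean_3_bounds:
  assumes "a > 0" "b > 0" "a \<noteq> b"
  shows "gen_log_mean 3 a b < arith_mean a b" "harm_mean a b < gen_log_mean (-3) a b"
proof -
  have *: "gen_log_mean 3 a b < arith_mean a b \<and> harm_mean a b < gen_log_mean (-3) a b"
    if "a > 0" "b > 0" "b < a" for a b
  proof -
    obtain m t where "a = exp (m + t)" "b = exp (m - t)" "t > 0"
      using exp_coordinates_ordered[OF \<open>a > 0\<close> \<open>b > 0\<close> \<open>b < a\<close>] .
    then show ?thesis
      using log_sinhc_slope_3_less[of t]
      by (simp add: gen_log_mean_exp arith_mean_exp harm_mean_exp)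
  qed
  have "arith_mean b a = arith_mean a b" "harm_mean b a = harm_mean a b"
    by (simp_all add: arith_mean_def harm_mean_def ac_simps)
  then show "gen_log_mean 3 a b < arith_mean a b" "harm_mean a b < gen_log_mean (-3) a b"
    using *[of a b] *[of b a] assms gen_log_mean_commute[of a b] by (cases "b < a"; force)+
qed

lemma gen_log_mean_3_le_arith_mean: "mean_le (gen_log_mean 3) arith_mean"
  unfolding mean_le_def
proof (intro allI impI)
  fix a b :: real assume "a > 0" "b > 0"
  then show "gen_log_mean 3 a b \<le> arith_mean a b"
    using gen_log_mean_3_bounds(1)[of a b]
    by (cases "a = b") (auto simp: arith_mean_def gen_log_mean_def[of _ b b])
qed

lemma harm_mean_le_gen_log_mean: "mean_le harm_mean (gen_log_mean (-3))"
  unfolding mean_le_def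
proof (intro allI impI)
  fix a b :: real assume "a > 0" "b > 0"
  then show "harm_mean a b \<le> gen_log_mean (-3) a b"
    using gen_log_mean_3_bounds(2)[of a b]
    by (cases "a = b") (auto simp: harm_mean_def gen_log_mean_def[of _ b b])
qed

section \<open>Sharpness of the exponents and the cancelling property\<close>

lemma mean_le_expD: "mean_le M N \<Longrightarrow> M (exp x) (exp y) \<le> N (exp x) (exp y)"
  by (simp add: mean_le_def)

text \<open>Comparing at m = 0 loses nothing, by homogeneity.\<close>

lemma mean_le_arith_meanD:
  "mean_le (gen_log_mean p) arith_mean \<Longrightarrow> t * log_sinhc_slope (p * t) \<le> ln (cosh t)"
  using mean_le_expD[of "gen_log_mean p" "arith_mean" "0 + t" "0 - t"]
  unfolding gen_log_mean_exp arith_mean_exp by (simp del: exp_ln)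

lemma arith_mean_leD:
  "mean_le arith_mean (gen_log_mean p) \<Longrightarrow> ln (cosh t) \<le> t * log_sinhc_slope (p * t)"
  using mean_le_expD[of "arith_mean" "gen_log_mean p" "0 + t" "0 - t"]
  unfolding gen_log_mean_exp arith_mean_exp by (simp del: exp_ln)

text \<open>Oddness absorbs the minus sign of the harmonic mean into p, so that conditions on
  \<open>harm_mean\<close> become those on \<open>arith_mean\<close> for the exponent -p.\<close>

lemma mean_le_harm_meanD:
  "mean_le (gen_log_mean p) harm_mean \<Longrightarrow> ln (cosh t) \<le> t * log_sinhc_slope (- p * t)"
  using mean_le_expD[of "gen_log_mean p" "harm_mean" "0 + t" "0 - t"]
  unfolding gen_log_mean_exp harm_mean_exp by simp

lemma harm_mean_leD:
  "mean_le harm_mean (gen_log_mean p) \<Longrightarrow> t * log_sinhc_slope (- p * t) \<le> ln (cosh t)"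
  using mean_le_expD[of "harm_mean" "gen_log_mean p" "0 + t" "0 - t"]
  unfolding gen_log_mean_exp harm_mean_exp by simp

text \<open>Near 0, ln (cosh t) behaves like t^2 / 2 and t * \<open>log_sinhc_slope (p * t)\<close>
  like p t^2 / 6.\<close>

lemma le_3_if_log_sinhc_slope_le:
  assumes le: "\<And>t. t * log_sinhc_slope (p * t) \<le> ln (cosh t)"
  shows "p \<le> 3"
proof (cases "p > 0")
  case True
  have "((\<lambda>t. (ln (cosh t) - t * (ln (sinh (p * t) / (p * t)) / (p * t))) / t\<^sup>2)
      \<longlongrightarrow> 1 / 2 - p / 6) (at_right 0)"
    using True unfolding sinh_field_def cosh_field_def by (real_asymp simp: field_simps)
  moreover have "\<And>t. 0 \<le> (ln (cosh t) - t * (ln (sinh (p * t) / (p * t)) / (p * t))) / t\<^sup>2"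
    using le by (simp add: log_sinhc_slope_def)
  ultimately have "0 \<le> 1 / 2 - p / 6"
    by (intro tendsto_lowerbound) auto
  then show ?thesis by simp
qed auto

lemma log_sinhc_slope_not_ge:
  assumes ge: "\<And>t. ln (cosh t) \<le> t * log_sinhc_slope (p * t)"
  shows False
proof -
  \<comment> \<open>Monotonicity allows p to be replaced by a larger, positive exponent.\<close>
  define q where "q = max p 1"
  have q: "q > 0" by (simp add: q_def)
  \<comment> \<open>The bounds cosh t > exp t / 2 and sinh (q t) < exp (q t) will give ln (q t) < q
    ln 2; this t makes the two sides equal.\<close>
  define t where "t = 2 powr q / q"
  have t: "t > 0" using q by (simp add: t_def)
  have "ln (exp t / 2) \<le> ln (cosh t)"
    by (subst ln_le_cancel_iff) (simp_all add: cosh_field_def add_pos_pos)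
  also have "\<dots> \<le> t * log_sinhc_slope (p * t)" by (rule ge)
  also have "\<dots> \<le> t * log_sinhc_slope (q * t)"
    using t by (intro mult_left_mono log_sinhc_slope_mono) (auto simp: q_def)
  also have "\<dots> = ln (sinh (q * t) / (q * t)) / q"
    using t by (simp add: log_sinhc_slope_def)
  also have "ln (exp t / 2) = t - ln 2"
    by (simp add: ln_div)
  finally have "q * (t - ln 2) \<le> ln (sinh (q * t) / (q * t))"
    using q by (simp add: pos_le_divide_eq mult.commute)
  also have "\<dots> < ln (exp (q * t) / (q * t))"
    using q t by (subst ln_less_cancel_iff)
      (auto simp: sinh_field_def field_simps intro!: add_pos_pos)
  also have "\<dots> = q * t - ln (q * t)"
    using q t by (simp add: ln_div)
  also have "q * t = 2 powr q" using q by (simp add: t_def)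
  finally show False
    using q \<open>q * t = 2 powr q\<close> by (simp add: ln_powr algebra_simps)
qed

theorem theorem1p1:
  shows "left_cancelling_mean (range gen_log_mean) harm_mean
    \<and> right_cancelling_mean (range gen_log_mean) arith_mean
    \<and> (\<forall>p a b :: real. -3 < p \<and> p < 3 \<and> a > 0 \<and> b > 0 \<and> a \<noteq> b \<longrightarrow>
          harm_mean a b < gen_log_mean (-3) a b
        \<and> gen_log_mean (-3) a b < gen_log_mean p a b
        \<and> gen_log_mean p a b < gen_log_mean 3 a b
        \<and> gen_log_mean 3 a b < arith_mean a b)
    \<and> mean_le (gen_log_mean 3) arith_mean
    \<and> (\<forall>p :: real. mean_le (gen_log_mean p) arith_mean \<longrightarrow> p \<le> 3)
    \<and> mean_le harm_mean (gen_log_mean (-3))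
    \<and> (\<forall>p :: real. mean_le harm_mean (gen_log_mean p) \<longrightarrow> -3 \<le> p)"
proof (intro conjI allI impI; (elim conjE)?)
  have sub: "range gen_log_mean \<subseteq> Omega"
    using gen_log_mean_in_Omega by blast
  have "\<not> mean_le (gen_log_mean p) harm_mean" for p
    using mean_le_harm_meanD log_sinhc_slope_not_ge by blast
  then show "left_cancelling_mean (range gen_log_mean) harm_mean"
    using sub ordered_family_gen_log_mean is_mean_harm_mean harm_mean_le_gen_log_mean
    unfolding left_cancelling_mean_def by blast
  have "\<not> mean_le arith_mean (gen_log_mean p)" for p
    using arith_mean_leD log_sinhc_slope_not_ge by blast
  then show "right_cancelling_mean (range gen_log_mean) arith_mean"
    using sub ordered_family_gen_log_mean is_mean_arith_mean gen_log_mean_3_le_arith_mean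
    unfolding right_cancelling_mean_def by blast
next
  fix p assume "mean_le harm_mean (gen_log_mean p)"
  \<comment> \<open>The hypothesis is the arithmetic-mean condition for the exponent -p.\<close>
  then have "- p \<le> 3"
    using harm_mean_leD le_3_if_log_sinhc_slope_le by blast
  then show "-3 \<le> p" by simp
next
  fix p assume "mean_le (gen_log_mean p) arith_mean"
  then show "p \<le> 3"
    using mean_le_arith_meanD le_3_if_log_sinhc_slope_le by blast
qed (auto intro: gen_log_mean_3_bounds gen_log_mean_strict_mono
    gen_log_mean_3_le_arith_mean harm_mean_le_gen_log_mean)

end
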